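(* Consider a wireless network in the Euclidean plane with path-loss exponent $\alpha>2$ and minimum SINR threshold $\beta$ required for successful reception, in which all nodes transmit with the same power $P$ and the ambient noise is neglected. Let $d_{max}$ and $d_{min}$ be the maximum and minimum link length in the network, let $k=\lfloor\log_2(d_{max}/d_{min})\rfloor$ be the length diversity, and let $$\rho=4\left(2\pi\beta\,\frac{\alpha-1}{\alpha-2}\right)^{1/\alpha}.$$ If the carrier sensing range (of every node) is set to be $R_C=\rho\,2^k$, then the transmitting links in the network will not be interfered with by all the other links; that is, every transmitting link, from a sender $v_i$ to a receiver $v_j$, satisfies $SINR(v_j)\ge\beta$ in the presence of all the other concurrently transmitting links.
   Context: Nodes are points in the Euclidean plane; a link $e_{ij}$ is a directed edge from sender $v_i$ to receiver $v_j$, with length $d(v_i,v_j)$. Physical interference model with noise neglected: the power received at $v_j$ from a sender $v_l$ is $P/d(v_l,v_j)^\alpha$, and for a transmitting link from $v_i$ to $v_j$ $$SINR(v_j)=\frac{P/d(v_i,v_j)^\alpha}{\sum_{v_l}P/d(v_l,v_j)^\alpha},$$ the sum being over all sending nodes $v_l\ne v_i$ transmitting concurrently with $v_i$. Reception at $v_j$ is successful if and only if $SINR(v_j)\ge\beta$. Carrier sensing with range $R_C$ means that each concurrently sending node lies outside the carrier sensing range $R_C$ of every other sending node.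
   Formalization: Two assumptions are added, without which the claim fails: the minimum link length d_min is at most 1 (fixing the unit of length in R_C = ρ2^k), and ρ ≥ 4, i.e. 2πβ(α−1)/(α−2) ≥ 1, which is automatic for β ≥ 1/(2π). *)

theory Defs
  imports "HOL-Analysis.Analysis"
begin

type_synonym node = "real^2"

type_synonym link = "node \<times> node"

definition link_length :: "link \<Rightarrow> real" where
  "link_length e = dist (fst e) (snd e)"

definition wireless_network :: "link set \<Rightarrow> bool" where
  "wireless_network L \<longleftrightarrow> finite L \<and> L \<noteq> {} \<and> (\<forall>e\<in>L. fst e \<noteq> snd e)"

definition d_max :: "link set \<Rightarrow> real" where
  "d_max L = Max (link_length ` L)"

definition d_min :: "link set \<Rightarrow> real" where
  "d_min L = Min (link_length ` L)"

definition length_diversity :: "link set \<Rightarrow> int" where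
  "length_diversity L = \<lfloor>log 2 (d_max L / d_min L)\<rfloor>"

definition senders :: "link set \<Rightarrow> node set" where
  "senders T = fst ` T"

(* Powers and SINR are extended nonnegative reals. There a / 0 = \<infinity> for a > 0,
   so a sender located at v contributes infinite power, and a link without any
   concurrent sender has SINR \<infinity>; over the reals both would be 0. *)
definition received_power :: "real \<Rightarrow> real \<Rightarrow> node \<Rightarrow> node \<Rightarrow> ennreal" where
  "received_power P \<alpha> u v = ennreal P / ennreal (dist u v powr \<alpha>)"

definition SINR :: "real \<Rightarrow> real \<Rightarrow> link set \<Rightarrow> link \<Rightarrow> ennreal" where
  "SINR P \<alpha> T e =
     received_power P \<alpha> (fst e) (snd e) /
     (\<Sum>u\<in>senders T - {fst e}. received_power P \<alpha> u (snd e))"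

definition successful_reception :: "real \<Rightarrow> real \<Rightarrow> real \<Rightarrow> link set \<Rightarrow> link \<Rightarrow> bool" where
  "successful_reception P \<alpha> \<beta> T e \<longleftrightarrow> SINR P \<alpha> T e \<ge> ennreal \<beta>"

definition carrier_sensing :: "real \<Rightarrow> link set \<Rightarrow> bool" where
  "carrier_sensing R T \<longleftrightarrow>
     (\<forall>u\<in>senders T. \<forall>v\<in>senders T. u \<noteq> v \<longrightarrow> dist u v > R)"

(* A range rho * 2^k is a length only relative to a unit; it fits links of length
   at most 2^(k+1), i.e. d_min L \<le> 1. Moreover rho \<rightarrow> 0 as \<beta> \<rightarrow> 0, and 4 is the least lower
   bound on rho, uniform in \<alpha>, that prevents a carrier-sensing-admissible sender close
   to a receiver from violating the threshold; it holds whenever \<beta> \<ge> 1 / (2 * pi). *)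
definition rho :: "real \<Rightarrow> real \<Rightarrow> real" where
  "rho \<alpha> \<beta> = 4 * (2 * pi * \<beta> * ((\<alpha> - 1) / (\<alpha> - 2))) powr (1 / \<alpha>)"

end

(* Put r = R_C / 2. Since every link is shorter than 2^(k+1) <= r, concurrent senders, being more
   than 2r apart, have distance at least r from the receiver. The discs of radius r around them are
   disjoint, so by area at most ((x + r) / r)^2 of them lie within distance x of the receiver.
   Integrating this count bounds the interference, and 4 <= 2 * pi absorbs the packing constant. *)

theory Submission
  imports Defs
begin

text \<open>Volume comparison: the open balls of radius \<open>r\<close> around the points are
  disjoint and lie in the ball of radius \<open>t + r\<close> about \<open>c\<close>. The unit-ball
  volume cancels.\<close>

lemma card_packing_le:
  fixes U :: "'a::euclidean_space set"
  assumes "finite U" "U \<subseteq> cball c t" "r > 0" "t \<ge> 0"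
    and sep: "\<And>u v. u \<in> U \<Longrightarrow> v \<in> U \<Longrightarrow> u \<noteq> v \<Longrightarrow> dist u v \<ge> 2 * r"
  shows "real (card U) * r ^ DIM('a) \<le> (t + r) ^ DIM('a)"
proof -
  have disj: "pairwise (\<lambda>u v. disjnt (ball u r) (ball v r)) U"
    unfolding pairwise_def disjnt_def by (metis sep disjoint_ballI mult_2)
  have "(\<Union>u\<in>U. ball u r) \<subseteq> ball c (t + r)"
  proof
    fix x assume "x \<in> (\<Union>u\<in>U. ball u r)"
    then obtain u where u: "u \<in> U" "dist u x < r"
      by auto
    moreover have "dist c u \<le> t"
      using u assms(2) by auto
    ultimately show "x \<in> ball c (t + r)"
      using dist_triangle[of c x u] by auto
  qed
  then have "measure lebesgue (\<Union>u\<in>U. ball u r) \<le> measure lebesgue (ball c (t + r))"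
    using assms by (intro measure_mono_fmeasurable) auto
  also have "measure lebesgue (\<Union>u\<in>U. ball u r) = (\<Sum>u\<in>U. measure lebesgue (ball u r))"
    using assms disj by (intro measure_UNION') auto
  finally have "real (card U) * (unit_ball_vol (real DIM('a)) * r ^ DIM('a))
      \<le> unit_ball_vol (real DIM('a)) * (t + r) ^ DIM('a)"
    using assms by (simp add: content_ball)
  moreover have "unit_ball_vol (real DIM('a)) > 0"
    by simp
  ultimately show ?thesis
    by (simp add: mult.left_commute)
qed

text \<open>The factor \<open>p\<close> normalises the antiderivative. Used below with
  \<open>p\<close> equal to \<alpha>, \<alpha> - 1 and \<alpha> - 2; the last converges because
  \<alpha> > 2.\<close>

lemma has_integral_powr_tail:
  fixes p r :: real
  assumes "p > 0" "r > 0"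
  shows "((\<lambda>x. p * x powr (- p - 1)) has_integral r powr (- p)) {r..}"
proof -
  have "((\<lambda>x. p * x powr (- p - 1)) has_integral
      p * (- (r powr (- p - 1 + 1)) / (- p - 1 + 1))) {r..}"
    using assms by (intro has_integral_mult_right has_integral_powr_to_inf) auto
  also have "p * (- (r powr (- p - 1 + 1)) / (- p - 1 + 1)) = r powr (- p)"
    using assms by (simp add: field_simps)
  finally show ?thesis .
qed

text \<open>Layer-cake: each term is \<open>t powr (- \<alpha>) = \<integral>\<^sub>t\<^sup>\<infinity> \<alpha> x powr (- \<alpha> - 1) dx\<close>, so the sum is the
  integral of \<open>\<alpha> x powr (- \<alpha> - 1)\<close> against the number of points within distance \<open>x\<close>.\<close>

lemma sum_powr_separated_le:
  fixes U :: "(real^2) set" and \<alpha> r :: real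
  assumes "finite U" "r > 0" "\<alpha> > 2"
    and sep: "\<And>u v. u \<in> U \<Longrightarrow> v \<in> U \<Longrightarrow> u \<noteq> v \<Longrightarrow> dist u v \<ge> 2 * r"
    and far: "\<And>u. u \<in> U \<Longrightarrow> dist u c \<ge> r"
  shows "(\<Sum>u\<in>U. dist u c powr (- \<alpha>))
    \<le> (\<alpha> / (\<alpha> - 2) + 2 * \<alpha> / (\<alpha> - 1) + 1) * r powr (- \<alpha>)"
proof -
  define w where "w = (\<lambda>x. \<alpha> * x powr (- \<alpha> - 1))"
  \<comment> \<open>\<open>G\<close> is \<open>w\<close> times the packing bound (x/r + 1)^2 =
    x^2/r^2 + 2x/r + 1, with each summand written as a constant times an integrand of
    \<open>has_integral_powr_tail\<close>.\<close>
  define G where "G = (\<lambda>x. \<alpha> / (\<alpha> - 2) / r\<^sup>2 * ((\<alpha> - 2) * x powr (- (\<alpha> - 2) - 1))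
      + 2 * \<alpha> / (\<alpha> - 1) / r * ((\<alpha> - 1) * x powr (- (\<alpha> - 1) - 1)) + w x)"
  \<comment> \<open>By \<open>far\<close> every tail starts at or after \<open>r\<close>, so all of
    them can be integrated over the same half-line.\<close>
  have "((\<lambda>x. if x \<in> {dist u c..} then w x else 0) has_integral dist u c powr (- \<alpha>)) {r..}"
    if "u \<in> U" for u
  proof -
    have "0 < dist u c"
      using far[OF that] assms by linarith
    then show ?thesis
      using has_integral_powr_tail[of \<alpha> "dist u c"] far[OF that] assms
      by (subst has_integral_restrict) (auto simp: w_def)
  qed
  then have S: "((\<lambda>x. \<Sum>u\<in>U. if x \<in> {dist u c..} then w x else 0)
      has_integral (\<Sum>u\<in>U. dist u c powr (- \<alpha>))) {r..}"
    using assms by (intro has_integral_sum) auto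
  have "(G has_integral (\<alpha> / (\<alpha> - 2) / r\<^sup>2 * r powr (- (\<alpha> - 2))
      + 2 * \<alpha> / (\<alpha> - 1) / r * r powr (- (\<alpha> - 1)) + r powr (- \<alpha>))) {r..}"
    unfolding G_def w_def using assms
    by (intro has_integral_add has_integral_mult_right has_integral_powr_tail) auto
  also have "\<alpha> / (\<alpha> - 2) / r\<^sup>2 * r powr (- (\<alpha> - 2))
      + 2 * \<alpha> / (\<alpha> - 1) / r * r powr (- (\<alpha> - 1)) + r powr (- \<alpha>)
      = (\<alpha> / (\<alpha> - 2) + 2 * \<alpha> / (\<alpha> - 1) + 1) * r powr (- \<alpha>)"
  proof -
    have "r powr (- (\<alpha> - 2)) = r\<^sup>2 * r powr (- \<alpha>)" "r powr (- (\<alpha> - 1)) = r * r powr (- \<alpha>)"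
      using assms powr_add[of r 2 "- \<alpha>"] powr_add[of r 1 "- \<alpha>"] by simp_all
    then show ?thesis
      using assms by (simp add: distrib_right)
  qed
  finally have I: "(G has_integral (\<alpha> / (\<alpha> - 2) + 2 * \<alpha> / (\<alpha> - 1) + 1) * r powr (- \<alpha>)) {r..}" .
  have "(\<Sum>u\<in>U. if x \<in> {dist u c..} then w x else 0) \<le> G x" if "x \<in> {r..}" for x
  proof -
    have x: "x > 0"
      using that assms by auto
    \<comment> \<open>At radius \<open>x\<close> exactly the points of \<open>V\<close> contribute,
      each with the same weight \<open>w x\<close>, so only their number matters.\<close>
    define V where "V = {u\<in>U. dist u c \<le> x}"
    have "real (card V) * r ^ DIM(real^2) \<le> (x + r) ^ DIM(real^2)"
      using assms x by (intro card_packing_le[of V c]) (auto simp: V_def dist_commute)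
    then have "real (card V) \<le> (x + r)\<^sup>2 / r\<^sup>2"
      using assms by (simp add: pos_le_divide_eq)
    also have "\<dots> = x\<^sup>2 / r\<^sup>2 + 2 * x / r + 1"
      using assms by (simp add: field_simps power2_eq_square)
    finally have card: "real (card V) \<le> x\<^sup>2 / r\<^sup>2 + 2 * x / r + 1" .
    have "(\<Sum>u\<in>U. if x \<in> {dist u c..} then w x else 0) = real (card V) * w x"
      using assms by (simp add: V_def sum.If_cases Int_def)
    also have "\<dots> \<le> (x\<^sup>2 / r\<^sup>2 + 2 * x / r + 1) * w x"
      using assms by (intro mult_right_mono card) (auto simp: w_def)
    also have "\<dots> = G x"
    proof -
      have "x powr (- (\<alpha> - 2) - 1) = x\<^sup>2 * x powr (- \<alpha> - 1)"
        "x powr (- (\<alpha> - 1) - 1) = x * x powr (- \<alpha> - 1)"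
        using x powr_add[of x 2 "- \<alpha> - 1"] powr_add[of x 1 "- \<alpha> - 1"] by simp_all
      then show ?thesis
        using assms by (simp add: G_def w_def distrib_right) (simp add: algebra_simps)
    qed
    finally show ?thesis .
  qed
  from has_integral_le[OF S I this] show ?thesis .
qed

text \<open>With q = (\<alpha> - 1)/(\<alpha> - 2), the first and last summands give exactly 2q, and
  the middle one is at most 2q because \<alpha>(\<alpha> - 2) = (\<alpha> - 1)^2 - 1. The total 4q
  is below 2 pi q.\<close>

lemma packing_constant_le:
  fixes \<alpha> :: real
  assumes "\<alpha> > 2"
  shows "\<alpha> / (\<alpha> - 2) + 2 * \<alpha> / (\<alpha> - 1) + 1 \<le> 2 * pi * ((\<alpha> - 1) / (\<alpha> - 2))"
proof -
  have "\<alpha> * (\<alpha> - 2) \<le> (\<alpha> - 1) * (\<alpha> - 1)"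
    by (simp add: algebra_simps)
  then have "\<alpha> / (\<alpha> - 1) \<le> (\<alpha> - 1) / (\<alpha> - 2)"
    using assms by (simp add: divide_simps mult.commute)
  moreover have "\<alpha> / (\<alpha> - 2) + 1 = 2 * ((\<alpha> - 1) / (\<alpha> - 2))"
    using assms by (simp add: field_simps)
  moreover have "4 * ((\<alpha> - 1) / (\<alpha> - 2)) \<le> 2 * pi * ((\<alpha> - 1) / (\<alpha> - 2))"
    using assms pi_gt3 by (intro mult_right_mono) auto
  moreover have "2 * \<alpha> / (\<alpha> - 1) = 2 * (\<alpha> / (\<alpha> - 1))"
    by simp
  ultimately show ?thesis
    by linarith
qed

text \<open>The floor in the length diversity makes 2^(k+1) strictly exceed the ratio of extreme
  lengths; \<open>d_min L \<le> 1\<close> turns this relative bound into an absolute one.\<close>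

lemma link_length_less_powi:
  assumes L: "wireless_network L" and "d_min L \<le> 1" and e: "e \<in> L"
  shows "link_length e < 2 * 2 powi length_diversity L"
proof -
  have fin: "finite (link_length ` L)" "link_length ` L \<noteq> {}"
    using L by (auto simp: wireless_network_def)
  have min_pos: "d_min L > 0"
    using L fin Min_in[OF fin] by (auto simp: wireless_network_def d_min_def link_length_def)
  have le: "link_length e \<le> d_max L" "d_min L \<le> link_length e"
    using fin e by (auto simp: d_max_def d_min_def)
  have "d_max L / d_min L > 0"
    using min_pos le by simp
  moreover have "log 2 (d_max L / d_min L) < real_of_int (length_diversity L + 1)"
    by (simp add: length_diversity_def)
  ultimately have "d_max L / d_min L < 2 powr real_of_int (length_diversity L + 1)"
    by (subst (asm) log_less_iff) auto
  also have "\<dots> = 2 * 2 powi length_diversity L"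
    by (simp add: powr_add powr_real_of_int')
  finally have "d_max L < 2 * 2 powi length_diversity L * d_min L"
    using min_pos by (simp add: field_simps)
  also have "\<dots> \<le> 2 * 2 powi length_diversity L"
    using assms by (intro mult_left_le) auto
  finally show ?thesis
    using le by simp
qed

text \<open>Passes from extended to real arithmetic: no sender sits at the receiver, so all powers
  are finite, and \<open>P\<close> cancels from the quotient.\<close>

lemma successful_receptionI:
  assumes "P > 0" "\<beta> > 0" "fst e \<noteq> snd e" "finite T"
    and far: "\<And>u. u \<in> senders T - {fst e} \<Longrightarrow> u \<noteq> snd e"
    and le: "\<beta> * (\<Sum>u\<in>senders T - {fst e}. dist u (snd e) powr (- \<alpha>)) \<le> link_length e powr (- \<alpha>)"
  shows "successful_reception P \<alpha> \<beta> T e"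
proof -
  define S where "S = (\<Sum>u\<in>senders T - {fst e}. dist u (snd e) powr (- \<alpha>))"
  have rp: "received_power P \<alpha> u (snd e) = ennreal (P * dist u (snd e) powr (- \<alpha>))"
    if "u \<noteq> snd e" for u
    using that assms
    by (simp add: received_power_def divide_ennreal powr_minus divide_inverse)
  have "(\<Sum>u\<in>senders T - {fst e}. received_power P \<alpha> u (snd e))
      = (\<Sum>u\<in>senders T - {fst e}. ennreal (P * dist u (snd e) powr (- \<alpha>)))"
    using rp far by (intro sum.cong) auto
  also have "\<dots> = ennreal (P * S)"
    using assms by (subst sum_ennreal) (auto simp: S_def sum_distrib_left)
  finally have SINR: "SINR P \<alpha> T e = ennreal (P * link_length e powr (- \<alpha>)) / ennreal (P * S)"
    using assms rp[of "fst e"] by (simp add: SINR_def link_length_def)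
  have pos: "link_length e powr (- \<alpha>) > 0"
    using assms by (simp add: link_length_def)
  have "S \<ge> 0"
    unfolding S_def by (intro sum_nonneg) auto
  then consider "S = 0" | "S > 0"
    by linarith
  then show ?thesis
  proof cases
    \<comment> \<open>Without interference the quotient is a positive number over 0, which is
      infinite in \<open>ennreal\<close> and so meets any threshold.\<close>
    case 1
    then show ?thesis
      using assms pos by (simp add: successful_reception_def SINR ennreal_divide_zero)
  next
    case 2
    then have "\<beta> \<le> (P * link_length e powr (- \<alpha>)) / (P * S)"
      using le assms by (simp add: S_def field_simps)
    then show ?thesis
      using assms 2 pos
      by (simp add: successful_reception_def SINR divide_ennreal ennreal_leI)
  qed
qed

theorem theorem2:
  fixes L T :: "link set" and P \<alpha> \<beta> R_C :: real
  assumes "P > 0" and "\<alpha> > 2" and "\<beta> > 0"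
    and "rho \<alpha> \<beta> \<ge> 4"
    and "wireless_network L"
    and "d_min L \<le> 1"
    and "R_C = rho \<alpha> \<beta> * 2 powi length_diversity L"
    and "T \<subseteq> L"
    and "carrier_sensing R_C T"
  shows "\<forall>e\<in>T. successful_reception P \<alpha> \<beta> T e"
proof
  fix e assume e: "e \<in> T"
  \<comment> \<open>The factor 4 in \<open>rho\<close> splits as 2 * 2: one 2 turns 2^k into the
    link bound \<open>D\<close>, the other makes \<open>r\<close> half of
    \<open>R_C\<close>.\<close>
  define D :: real where "D = 2 * 2 powi length_diversity L"
  define X where "X = 2 * pi * \<beta> * ((\<alpha> - 1) / (\<alpha> - 2))"
  define r where "r = D * X powr (1 / \<alpha>)"
  define C where "C = \<alpha> / (\<alpha> - 2) + 2 * \<alpha> / (\<alpha> - 1) + 1"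
  define U where "U = senders T - {fst e}"
  have R: "R_C = 2 * r"
    using assms by (simp add: rho_def r_def D_def X_def)
  have D: "D > 0"
    by (simp add: D_def)
  have X: "X > 0"
    using assms by (simp add: X_def)
  \<comment> \<open>This is the assumption \<open>rho \<alpha> \<beta> \<ge> 4\<close> divided by
    4.\<close>
  have "X powr (1 / \<alpha>) \<ge> 1"
    using assms by (simp add: rho_def X_def)
  then have r: "r \<ge> D"
    using D by (simp add: r_def)
  have ne: "fst e \<noteq> snd e" and finT: "finite T"
    using assms e by (auto simp: wireless_network_def intro: finite_subset)
  then have finU: "finite U"
    by (simp add: U_def senders_def)
  have len: "link_length e < D" "link_length e > 0"
    using link_length_less_powi[of L e] assms e ne by (auto simp: D_def link_length_def)
  have sep: "dist u v \<ge> 2 * r" if "u \<in> senders T" "v \<in> senders T" "u \<noteq> v" for u v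
    using assms that unfolding R carrier_sensing_def by fastforce
  \<comment> \<open>Triangle inequality through the sender of \<open>e\<close>: the distance is at
    least 2r minus the link length, and that length is below \<open>D \<le> r\<close>.\<close>
  have far: "dist u (snd e) \<ge> r" if "u \<in> U" for u
    using sep[of u "fst e"] that e len r dist_triangle[of u "fst e" "snd e"]
    by (auto simp: U_def senders_def link_length_def dist_commute)
  have "(\<Sum>u\<in>U. dist u (snd e) powr (- \<alpha>)) \<le> C * r powr (- \<alpha>)"
    unfolding C_def using finU r D assms far sep
    by (intro sum_powr_separated_le) (auto simp: U_def)
  then have "\<beta> * (\<Sum>u\<in>U. dist u (snd e) powr (- \<alpha>)) \<le> \<beta> * C * r powr (- \<alpha>)"
    using assms by simp
  also have "\<dots> \<le> X * r powr (- \<alpha>)"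
    using mult_left_mono[OF packing_constant_le[of \<alpha>], of \<beta>] assms
    by (intro mult_right_mono) (auto simp: C_def X_def mult_ac)
  \<comment> \<open>The exponent 1/\<alpha> in \<open>rho\<close> is chosen for this: r^(-\<alpha>)
    = D^(-\<alpha>)/X, so \<open>X\<close> cancels.\<close>
  also have "\<dots> = D powr (- \<alpha>)"
    using assms D X by (simp add: r_def powr_mult powr_powr powr_minus field_simps)
  also have "\<dots> \<le> link_length e powr (- \<alpha>)"
    using len assms by (intro powr_mono2') auto
  finally show "successful_reception P \<alpha> \<beta> T e"
    using assms ne finT far r D
    by (intro successful_receptionI) (force simp: U_def)+
qed

end
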